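(* Let $\Gamma$ be the Sims-Gewirtz graph, the (unique) strongly regular graph with parameters $(56,10,0,2)$. Then the plus graph $\Gamma^+$ is connected.
   Context: A graph is strongly regular with parameters $(n,k,\lambda,\mu)$ if it has $n$ vertices, is $k$-regular, adjacent vertices have exactly $\lambda$ common neighbors and non-adjacent vertices have exactly $\mu$ common neighbors. For a graph $G$, its plus graph $G^+$ has one vertex $e^+$ for each edge $e$ of $G$, and $e^+f^+$ is an edge of $G^+$ if and only if $e$ and $f$ are two non-incident edges of a common 4-cycle of $G$. *)

theory Defs
  imports "Graph_Theory.Graph_Theory"
begin

text \<open>
  Finite simple graphs are the \<^locale>\<open>pair_graph\<close>s, i.e. finite, loop-free, symmetric digraphs in
  which an undirected edge \<open>{u, v}\<close> is represented by the two arcs \<open>(u, v)\<close> and \<open>(v, u)\<close>.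
\<close>

definition strongly_regular ::
  "'a pair_pre_digraph \<Rightarrow> nat \<Rightarrow> nat \<Rightarrow> nat \<Rightarrow> nat \<Rightarrow> bool" where
  "strongly_regular G n k l m \<longleftrightarrow>
     pair_graph G \<and>
     card (pverts G) = n \<and>
     (\<forall>u\<in>pverts G. out_degree (with_proj G) u = k) \<and>
     (\<forall>u\<in>pverts G. \<forall>v\<in>pverts G. (u, v) \<in> parcs G \<longrightarrow>
        card {w \<in> pverts G. (u, w) \<in> parcs G \<and> (v, w) \<in> parcs G} = l) \<and>
     (\<forall>u\<in>pverts G. \<forall>v\<in>pverts G. u \<noteq> v \<and> (u, v) \<notin> parcs G \<longrightarrow>
        card {w \<in> pverts G. (u, w) \<in> parcs G \<and> (v, w) \<in> parcs G} = m)"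

definition edge_of :: "'a \<times> 'a \<Rightarrow> 'a set" where
  "edge_of a = {fst a, snd a}"

definition edges :: "'a pair_pre_digraph \<Rightarrow> 'a set set" where
  "edges G = edge_of ` parcs G"

text \<open>
  A directed cycle of a symmetric digraph that has length 4 traverses four distinct vertices, so
  it is an (oriented) 4-cycle of the underlying undirected graph.  The vertex \<open>e\<^sup>+\<close> of the plus
  graph is the edge \<open>e\<close> itself, as a two-element set of vertices.
\<close>

definition plus_graph :: "'a pair_pre_digraph \<Rightarrow> 'a set pair_pre_digraph" where
  "plus_graph G =
     \<lparr> pverts = edges G,
       parcs = {(e, f). \<exists>p. pre_digraph.cycle (with_proj G) p \<and> length p = 4 \<and>
                  e \<in> edge_of ` set p \<and> f \<in> edge_of ` set p \<and> e \<inter> f = {}} \<rparr>"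

lemma four_cycle_iff:
  "pre_digraph.cycle (with_proj G) p \<and> length p = 4 \<longleftrightarrow>
     (\<exists>a b c d. p = [(a, b), (b, c), (c, d), (d, a)] \<and> distinct [a, b, c, d] \<and>
        a \<in> pverts G \<and> set p \<subseteq> parcs G)" (is "?L \<longleftrightarrow> ?R")
proof
  assume *: ?L
  then have "length p = Suc (Suc (Suc (Suc 0)))" by simp
  then obtain a1 b1 a2 b2 a3 b3 a4 b4 where p: "p = [(a1, b1), (a2, b2), (a3, b3), (a4, b4)]"
    unfolding length_Suc_conv by fastforce
  from * obtain u where u: "u \<in> pverts G" "set p \<subseteq> parcs G" "pcas u p u"
      "distinct (tl (pawalk_verts u p))"
    unfolding pre_digraph.cycle_def pre_digraph.awalk_def
      cas_with_proj_eq awalk_verts_with_proj_eq by (auto simp: with_proj_def)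
  then show ?R unfolding p by (simp) blast
next
  assume ?R
  then obtain a b c d where "p = [(a, b), (b, c), (c, d), (d, a)]" "distinct [a, b, c, d]"
        "a \<in> pverts G" "set p \<subseteq> parcs G" by blast
  then have "pcas a p a" "distinct (tl (pawalk_verts a p))" "p \<noteq> []" "length p = 4"
      "a \<in> pverts G" "set p \<subseteq> parcs G" by auto
  then show ?L unfolding pre_digraph.cycle_def pre_digraph.awalk_def
      cas_with_proj_eq awalk_verts_with_proj_eq by (auto simp: with_proj_def)
qed

lemma pair_graph_plus_graph:
  assumes "pair_graph G"
  shows "pair_graph (plus_graph G)"
proof -
  interpret pair_graph G by fact
  have sub: "parcs (plus_graph G) \<subseteq> edges G \<times> edges G"
    unfolding plus_graph_def edges_def cycle_def awalk_def by auto
  have fin: "finite (edges G)"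
    by (simp add: edges_def)
  have verts: "pverts (plus_graph G) = edges G"
    by (simp add: plus_graph_def)
  have fin_arcs: "finite (parcs (plus_graph G))"
    using sub fin by (meson finite_SigmaI finite_subset)
  have sym: "symmetric (with_proj (plus_graph G))"
    by (auto simp: symmetric_def sym_def plus_graph_def)
  have loopfree: "fst a \<noteq> snd a" if "a \<in> parcs (plus_graph G)" for a
    using that by (auto simp: plus_graph_def edge_of_def)
  have ends: "fst a \<in> edges G \<and> snd a \<in> edges G" if "a \<in> parcs (plus_graph G)" for a
    using sub that by (auto simp: mem_Times_iff)
  show ?thesis
    by unfold_locales (use verts fin fin_arcs sym loopfree ends in simp_all)
qed

end

theory Submission
  imports Defs
begin

text \<open>
  Colour the edges of \<open>\<Gamma>\<close> so that opposite edges of every 4-cycle get the same colour; it has to be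
  shown that all edges get the same colour.  All vertices have the same red degree \<open>r\<close>.

  Fix a vertex \<open>x\<close> and a vertex \<open>y\<close> not adjacent to it.  Join two of the 8 neighbours of \<open>x\<close> outside
  the neighbourhood of \<open>y\<close> if their common neighbour other than \<open>x\<close> is adjacent to \<open>y\<close>.  This graph
  is 2-regular, and the end points of each of its paths with three edges have the same colour (seen
  from \<open>x\<close>).  So its cycles other than triangles are monochromatic, whence it has at most two
  edges with differently coloured ends.  Counting over the 45 choices of \<open>y\<close> gives
  \<open>8 r (10 - r) \<le> 90\<close>, i.e. \<open>r \<in> {0, 1, 9, 10}\<close>.

  If \<open>r = 1\<close>, the red edges form a perfect matching \<open>\<sigma>\<close>, which is an automorphism.  (Its
  quotient would be a strongly regular graph with parameters \<open>(28, 9, 0, 4)\<close>, excluded by the Krein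
  condition.)  Non-neighbours of \<open>x\<close> correspond to pairs of neighbours of \<open>x\<close>, so \<open>\<sigma>\<close> induces an
  involution on the pairs of the 9 blue neighbours of \<open>x\<close>, and elementary properties of
  this involution are contradictory.
\<close>

section \<open>Coloured 2-regular graphs on eight points\<close>

text \<open>In the application \<open>S\<close> is the set of neighbours of \<open>x\<close> not
  adjacent to \<open>y\<close>, and \<open>c\<close> is the colour of the edge to \<open>x\<close>.
  \<open>colour_path\<close> allows \<open>e = f\<close>, where it says nothing; this is why
  triangles may be mixed.\<close>

locale coloured_two_regular =
  fixes S :: "'a set" and F :: "'a \<Rightarrow> 'a \<Rightarrow> bool" and c :: "'a \<Rightarrow> bool"
  assumes fin: "finite S" and card_S: "card S = 8"
    and irr: "\<not> F a a" and sym: "F a b \<Longrightarrow> F b a"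
    and F_S: "F a b \<Longrightarrow> a \<in> S"
    and deg: "a \<in> S \<Longrightarrow> card {b. F a b} = 2"
    and colour_path: "F e a \<Longrightarrow> F a b \<Longrightarrow> F b f \<Longrightarrow> e \<noteq> b \<Longrightarrow> a \<noteq> f \<Longrightarrow> c e = c f"
begin

lemma other_neighbour: "F u v \<Longrightarrow> \<exists>w. w \<noteq> v \<and> {b. F u b} = {v, w}"
proof -
  assume uv: "F u v"
  have "card {b. F u b} = 2" using deg F_S uv by blast
  then obtain p q where "{b. F u b} = {p, q}" "p \<noteq> q" by (auto simp: card_2_iff)
  with uv show ?thesis by (cases "v = p") auto
qed

text \<open>The two vertices left over could only be adjacent to each other, so they would have
  degree at most 1.\<close>

lemma no_closed_six:
  assumes X: "X \<subseteq> S" "card X = 6" and closed: "\<And>u v. u \<in> X \<Longrightarrow> F u v \<Longrightarrow> v \<in> X"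
  shows False
proof -
  have "card (S - X) = 2" using X card_S fin by (simp add: card_Diff_subset finite_subset)
  then obtain p q where pq: "S - X = {p, q}" "p \<noteq> q" by (auto simp: card_2_iff)
  have "{z. F p z} \<subseteq> {q}"
  proof
    fix z assume "z \<in> {z. F p z}"
    then have z: "F p z" "F z p" using sym by auto
    then have "z \<in> S" "z \<noteq> p" using F_S irr by auto
    moreover have "z \<notin> X" using closed z(2) pq by blast
    ultimately show "z \<in> {q}" using pq by auto
  qed
  moreover have "p \<in> S" using pq by auto
  ultimately show False using deg[of p] card_mono[of "{q}" "{z. F p z}"] by auto
qed

text \<open>Walking on from \<open>a b\<close> in both directions gives
  \<open>d e a b f g h\<close>. With A and B the colours of \<open>a\<close> and \<open>b\<close>,
  \<open>colour_path\<close> forces the pattern B A A B A A B of period 3, and this period fits no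
  cycle possible on eight vertices.\<close>

lemma no_mixed_path:
  assumes ab: "F a b" "c a \<noteq> c b" and eq: "F e a" "e \<noteq> b" "c e = c a" and
    notri: "\<nexists>e. F e a \<and> F e b"
  shows False
proof -
  obtain f where f: "f \<noteq> a" "{z. F b z} = {a, f}" using other_neighbour[OF sym[OF ab(1)]] by blast
  have Na: "{z. F a z} = {b, e}" using other_neighbour[OF ab(1)] sym[OF eq(1)] eq(2) by auto
  have Fbf: "F b f" using f by auto
  have cf: "c f = c a" using colour_path[OF eq(1) ab(1) Fbf] eq f by auto
  obtain g where g: "g \<noteq> b" "{z. F f z} = {b, g}" using other_neighbour[OF sym[OF Fbf]] by blast
  have Ffg: "F f g" using g by auto
  have cg: "c g = c a" using colour_path[OF ab(1) Fbf Ffg] f g by auto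
  obtain h where h: "h \<noteq> f" "{z. F g z} = {f, h}" using other_neighbour[OF sym[OF Ffg]] by blast
  have Fgh: "F g h" using h by auto
  have ch: "c h = c b" using colour_path[OF Fbf Ffg Fgh] g h by auto
  obtain d where d: "d \<noteq> a" "{z. F e z} = {a, d}" using other_neighbour[OF eq(1)] by blast
  have Fed: "F e d" using d by auto
  have cd: "c d = c b" using colour_path[OF sym[OF Fed] eq(1) ab(1)] eq d by auto
  have ef: "e \<noteq> f" using notri eq(1) sym[OF Fbf] by blast
  have eg: "e \<noteq> g"
  proof
    assume "e = g"
    with d h have "h = a" using ef f(1) by (auto simp: doubleton_eq_iff)
    with ch ab show False by simp
  qed
  have bf: "b \<noteq> f" using Fbf irr by auto
  have ag: "a \<noteq> g"
  proof
    assume "a = g"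
    then have "f \<in> {b, e}" using Na sym[OF Ffg] by auto
    then show False using bf ef by auto
  qed
  have ae: "a \<noteq> e" using eq irr by auto
  have fg: "f \<noteq> g" using Ffg irr by auto
  have db: "d \<noteq> b" using sym[OF Fed] f(2) ae ef by auto
  have hb: "h \<noteq> b" using sym[OF Fgh] f(2) ag fg by auto
  have dist: "distinct [a, b, e, f, g]" using ab cf cg eq ef eg ag ae fg f g by auto
  have red: "c a \<noteq> c d" "c a \<noteq> c h" using cd ch ab by auto
  then have dh: "d \<noteq> a" "d \<noteq> e" "d \<noteq> f" "d \<noteq> g" "h \<noteq> a" "h \<noteq> e" "h \<noteq> f" "h \<noteq> g"
    using eq cf cg by auto
  show False
  \<comment> \<open>If the two ends of the walk meet, the cycle has length 6 and is a closed set.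
    Otherwise seven vertices are in use.\<close>
  proof (cases "d = h")
    case True
    obtain w where Nd: "{z. F d z} = {e, w}" using other_neighbour[OF sym[OF Fed]] by blast
    moreover have "F d g" using sym[OF Fgh] True by simp
    ultimately have "w = g" using eg by auto
    show False
    proof (rule no_closed_six)
      show "card {a, b, e, f, g, d} = 6" using dist dh db by simp
      show "{a, b, e, f, g, d} \<subseteq> S"
        using F_S[OF ab(1)] F_S[OF Fbf] F_S[OF eq(1)] F_S[OF Ffg] F_S[OF Fgh] F_S[OF sym[OF Fed]]
        by auto
      show "v \<in> {a, b, e, f, g, d}" if "u \<in> {a, b, e, f, g, d}" "F u v" for u v
        using that Na f(2) d(2) g(2) h(2) Nd \<open>w = g\<close> True by auto
    qed
  next
    case False
    let ?X = "{a, b, e, f, g, d, h}"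
    have "card ?X = 7" using dist dh db hb False by simp
    moreover have "?X \<subseteq> S"
      using F_S[OF ab(1)] F_S[OF Fbf] F_S[OF eq(1)] F_S[OF Ffg] F_S[OF Fgh] F_S[OF sym[OF Fed]]
        F_S[OF sym[OF Fgh]] by auto
    ultimately have "card (S - ?X) = 1" using card_S fin by (subst card_Diff_subset) auto
    then obtain i where i: "S - ?X = {i}" by (auto simp: card_1_singleton_iff)
    obtain j where j: "j \<noteq> g" "{z. F h z} = {g, j}" using other_neighbour[OF sym[OF Fgh]] by blast
    have Fhj: "F h j" using j by auto
    have cj: "c j = c f" using colour_path[OF Ffg Fgh Fhj] h j by auto
    have "j \<noteq> a" "j \<noteq> b" "j \<noteq> e" "j \<noteq> f"
      using sym[OF Fhj] Na f(2) d(2) g(2) red cf cg eq hb False by auto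
    moreover have "j \<noteq> d" "j \<noteq> h" using cj cf red by auto
    \<comment> \<open>Both ends of the walk must continue to the only remaining vertex
      \<open>i\<close>. The 8-cycle closes, and its path \<open>d i h g\<close> contradicts the
      colour pattern.\<close>
    ultimately have "j = i" using i j(1) F_S[OF sym[OF Fhj]] by auto
    obtain k where k: "k \<noteq> e" "{z. F d z} = {e, k}" using other_neighbour[OF sym[OF Fed]] by blast
    have Fdk: "F d k" using k by auto
    have ck: "c k = c a" using colour_path[OF sym[OF Fdk] sym[OF Fed] eq(1)] d k by auto
    have "k \<noteq> a" "k \<noteq> b" "k \<noteq> f" "k \<noteq> g"
      using sym[OF Fdk] Na f(2) h(2) g(2) red cf cg eq db False by auto
    moreover have "k \<noteq> d" "k \<noteq> h" using ck red by auto
    ultimately have "k = i" using i k(1) F_S[OF sym[OF Fdk]] by auto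
    have "c d = c g"
      using colour_path[OF Fdk, of h g] Fhj sym[OF Fhj] sym[OF Fgh] \<open>j = i\<close> \<open>k = i\<close> False j by auto
    then show False using cg red by auto
  qed
qed

text \<open>Let \<open>e\<close> and \<open>f\<close> be the further neighbours of \<open>a\<close>
  and \<open>b\<close>. They have equal colours, and as there are only two colours, either
  \<open>e\<close> agrees with \<open>a\<close> or \<open>f\<close> agrees with \<open>b\<close>. In
  both cases \<open>no_mixed_path\<close> applies, in the second from the side of
  \<open>b\<close>.\<close>

lemma mixed_edge_in_triangle:
  assumes ab: "F a b" "c a \<noteq> c b"
  shows "\<exists>e. F e a \<and> F e b"
proof (rule ccontr)
  assume notri: "\<nexists>e. F e a \<and> F e b"
  obtain e where e: "e \<noteq> b" "{z. F a z} = {b, e}" using other_neighbour[OF ab(1)] by blast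
  obtain f where f: "f \<noteq> a" "{z. F b z} = {a, f}" using other_neighbour[OF sym[OF ab(1)]] by blast
  have Fe: "F e a" and Ff: "F f b" using e f sym by auto
  have "c e = c f" using colour_path[OF Fe ab(1) sym[OF Ff]] e f by auto
  show False
  proof (cases "c e = c a")
    case True
    then show False using no_mixed_path[OF ab Fe e(1)] notri by blast
  next
    case False
    then have "c f = c b" using \<open>c e = c f\<close> ab(2) by auto
    then show False using no_mixed_path[OF sym[OF ab(1)] _ Ff f(1)] ab(2) notri by metis
  qed
qed

lemma triangle_closed:
  assumes "F a b" "F e a" "F e b"
  shows "u \<in> {a, b, e} \<Longrightarrow> F u v \<Longrightarrow> v \<in> {a, b, e}"
proof -
  have "a \<noteq> b" "a \<noteq> e" "b \<noteq> e" using assms irr by auto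
  moreover have sy: "F b a" "F a e" "F b e" using assms sym by auto
  moreover obtain p q r where "{z. F a z} = {b, p}" "{z. F b z} = {a, q}" "{z. F e z} = {a, r}"
    using other_neighbour[OF assms(1)] other_neighbour[OF sy(1)] other_neighbour[OF assms(2)] by blast
  moreover from this have "e \<in> {b, p}" "e \<in> {a, q}" "b \<in> {a, r}" using assms sy by auto
  ultimately have "{z. F a z} = {b, e}" "{z. F b z} = {a, e}" "{z. F e z} = {a, b}" by auto
  then show "u \<in> {a, b, e} \<Longrightarrow> F u v \<Longrightarrow> v \<in> {a, b, e}" by auto
qed

text \<open>Every mixed edge lies in a triangle, which is a whole component. Two such triangles
  would form a closed set of six vertices, so there is only one.\<close>

lemma card_mixed_edges_le: "card {(a, b). F a b \<and> c a \<and> \<not> c b} \<le> 2"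
proof (cases "\<exists>a b. F a b \<and> c a \<and> \<not> c b")
  case False
  then have "{(a, b). F a b \<and> c a \<and> \<not> c b} = {}" by auto
  then show ?thesis by (simp only: card.empty zero_le)
next
  case True
  then obtain a b where ab: "F a b" "c a" "\<not> c b" by blast
  then obtain e where e: "F e a" "F e b" using mixed_edge_in_triangle by blast
  have sub: "u \<in> {a, b, e} \<and> v \<in> {a, b, e}" if uv: "F u v" "c u" "\<not> c v" for u v
  proof (rule ccontr)
    assume out: "\<not> ?thesis"
    obtain w where w: "F w u" "F w v" using mixed_edge_in_triangle uv by blast
    let ?T = "{a, b, e}" and ?U = "{u, v, w}"
    have cT: "q \<in> ?T" if "p \<in> ?T" "F p q" for p q using triangle_closed[OF ab(1) e] that by blast
    have cU: "q \<in> ?U" if "p \<in> ?U" "F p q" for p q using triangle_closed[OF uv(1) w] that by blast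
    have "u \<notin> ?T" "v \<notin> ?T" "w \<notin> ?T" using out cT uv(1) w sym by blast+
    then have disj: "?T \<inter> ?U = {}" by auto
    have "a \<noteq> b" "a \<noteq> e" "b \<noteq> e" "u \<noteq> v" "u \<noteq> w" "v \<noteq> w" using irr ab uv e w by auto
    then have "card ?T = 3" "card ?U = 3" by auto
    then have "card (?T \<union> ?U) = 6" using disj by (subst card_Un_disjoint) auto
    moreover have "?T \<union> ?U \<subseteq> S" using F_S ab(1) uv(1) e w sym by blast
    ultimately show False using no_closed_six[of "?T \<union> ?U"] cT cU by blast
  qed
  \<comment> \<open>A triangle with both colours has exactly two mixed edges; the colour of the
    third vertex \<open>e\<close> decides which.\<close>
  define K where "K = (if c e then {(a, b), (e, b)} else {(a, b), (a, e)})"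
  have "{(a, b). F a b \<and> c a \<and> \<not> c b} \<subseteq> K"
    unfolding K_def using sub ab by fastforce
  moreover have "finite K" "card K \<le> 2" by (auto simp: K_def card_insert_if)
  ultimately show ?thesis using card_mono le_trans by blast
qed

end

section \<open>Involutions on the pairs of a nine-element set\<close>

text \<open>\<open>T\<close> will be the set of blue neighbours of \<open>x\<close>. A pair
  \<open>P\<close> stands for the vertex other than \<open>x\<close> adjacent to both its elements,
  and \<open>m P\<close> is the pair of the mate of that vertex.\<close>

locale pair_involution =
  fixes T :: "'a set" and m :: "'a set \<Rightarrow> 'a set"
  assumes card_T: "card T = 9"
    and m_sub: "P \<subseteq> T \<Longrightarrow> card P = 2 \<Longrightarrow> m P \<subseteq> T"
    and m_card: "P \<subseteq> T \<Longrightarrow> card P = 2 \<Longrightarrow> card (m P) = 2"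
    and m_disj: "P \<subseteq> T \<Longrightarrow> card P = 2 \<Longrightarrow> m P \<inter> P = {}"
    and m_m: "P \<subseteq> T \<Longrightarrow> card P = 2 \<Longrightarrow> m (m P) = P"
    and m_sep: "P \<subseteq> T \<Longrightarrow> card P = 2 \<Longrightarrow> E \<subseteq> T \<Longrightarrow> card E = 2 \<Longrightarrow> E \<inter> (P \<union> m P) = {} \<Longrightarrow>
      m E \<inter> (P \<union> m P) = {}"
begin

lemma finite_T: "finite T"
  using card_T by (auto intro: card_ge_0_finite)

lemma card_block: "P \<subseteq> T \<Longrightarrow> card P = 2 \<Longrightarrow> card (P \<union> m P) = 4"
  using m_card[of P] m_disj[of P] m_sub[of P] finite_T
  by (subst card_Un_disjoint) (auto intro: finite_subset)

text \<open>This is the partition 9 = 4 + 4 + 1: two disjoint blocks, each a pair with its image,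
  and a single point \<open>s\<close>.\<close>

lemma obtain_separate_pairs:
  assumes P: "P \<subseteq> T" "card P = 2"
  obtains E e s where "E \<subseteq> T" "card E = 2" "E \<inter> (P \<union> m P) = {}" "e \<in> E"
    "T = insert s (P \<union> m P \<union> E \<union> m E)" "s \<notin> P \<union> m P \<union> E \<union> m E"
proof -
  let ?B = "P \<union> m P"
  have B: "?B \<subseteq> T" "card ?B = 4" using P m_sub card_block by auto
  then have "card (T - ?B) = 5"
    using card_T card_Diff_subset[OF finite_subset[OF B(1) finite_T] B(1)] by simp
  then obtain E where E: "E \<subseteq> T - ?B" "card E = 2"
    using obtain_subset_with_card_n[of 2 "T - ?B"] by auto
  then have E': "E \<subseteq> T" "E \<inter> ?B = {}" by auto
  then have "m E \<inter> ?B = {}" using m_sep P E by blast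
  then have EB: "(E \<union> m E) \<inter> ?B = {}" using E' by auto
  have C: "E \<union> m E \<subseteq> T" "card (E \<union> m E) = 4" using E E' m_sub card_block by auto
  have "finite (E \<union> m E)" "finite ?B" using B C finite_T finite_subset by blast+
  then have "card (?B \<union> (E \<union> m E)) = 8" using EB B C by (subst card_Un_disjoint) auto
  moreover have BC: "?B \<union> (E \<union> m E) \<subseteq> T" using B C by blast
  ultimately have "card (T - (?B \<union> (E \<union> m E))) = 1"
    using card_T card_Diff_subset[OF finite_subset[OF BC finite_T] BC] by simp
  then obtain s where s: "T - (?B \<union> (E \<union> m E)) = {s}" by (auto simp: card_1_singleton_iff)
  obtain e where "e \<in> E" using E by fastforce
  then show ?thesis using that[of E e s] E E' B C s by blast
qed

text \<open>By \<open>m_sep\<close> the image of \<open>{c, p}\<close> avoids the second block as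
  well as the block of \<open>{e, s}\<close>. Only the two other points of the block of
  \<open>P\<close> remain.\<close>

lemma m_transversal:
  assumes P: "P \<subseteq> T" "card P = 2" and cp: "c \<in> P" "p \<in> m P"
  shows "m {c, p} = (P \<union> m P) - {c, p}"
proof -
  obtain E e s where E: "E \<subseteq> T" "card E = 2" "E \<inter> (P \<union> m P) = {}" "e \<in> E"
    "T = insert s (P \<union> m P \<union> E \<union> m E)" "s \<notin> P \<union> m P \<union> E \<union> m E"
    using obtain_separate_pairs[OF P] by blast
  have "c \<noteq> p" using cp m_disj P by blast
  then have Q: "{c, p} \<subseteq> T" "card {c, p} = 2" using P cp m_sub by auto
  have mE: "m E \<inter> (P \<union> m P) = {}" using m_sep P E by blast
  then have 1: "m {c, p} \<inter> (E \<union> m E) = {}" using m_sep[OF E(1,2) Q] E(3) cp by auto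
  have "e \<noteq> s" using E by blast
  then have F: "{e, s} \<subseteq> T" "card {e, s} = 2" "{e, s} \<inter> (P \<union> m P) = {}" using E by auto
  then have "m {e, s} \<inter> (P \<union> m P) = {}" using m_sep P by blast
  then have 2: "s \<notin> m {c, p}" using m_sep[OF F(1,2) Q] F(3) cp by auto
  have "m {c, p} \<subseteq> (P \<union> m P) - {c, p}" using 1 2 E(5) m_sub[OF Q] m_disj[OF Q] by blast
  moreover have "card ((P \<union> m P) - {c, p}) = 2"
    using card_block[OF P] Q cp by (simp add: card_Diff_subset)
  moreover have "finite ((P \<union> m P) - {c, p})"
    using finite_subset[OF _ finite_T] P m_sub[OF P] by simp
  ultimately show ?thesis using m_card[OF Q] by (simp add: card_subset_eq)
qed

text \<open>The image of \<open>{e, s}\<close> lies in the block of \<open>E\<close> and omits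
  \<open>e\<close>. It is either \<open>m E\<close> or a transversal pair \<open>{f, g}\<close>;
  applying \<open>m\<close> again gives a pair inside the block of \<open>E\<close>, although
  \<open>s\<close> lies outside.\<close>

lemma inconsistent: False
proof -
  obtain P where P: "P \<subseteq> T" "card P = 2" using obtain_subset_with_card_n[of 2 T] card_T by auto
  obtain E e s where E: "E \<subseteq> T" "card E = 2" "E \<inter> (P \<union> m P) = {}" "e \<in> E"
    "T = insert s (P \<union> m P \<union> E \<union> m E)" "s \<notin> P \<union> m P \<union> E \<union> m E"
    using obtain_separate_pairs[OF P] by blast
  have "e \<noteq> s" using E by blast
  then have F: "{e, s} \<subseteq> T" "card {e, s} = 2" "{e, s} \<inter> (P \<union> m P) = {}" using E by auto
  have "m {e, s} \<inter> (P \<union> m P) = {}" using m_sep P F by blast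
  then have sub: "m {e, s} \<subseteq> E \<union> m E" using E(5) m_sub[OF F(1,2)] m_disj[OF F(1,2)] by blast
  obtain f where f: "E = {e, f}" "f \<noteq> e" using E(2,4) by (auto simp: card_2_iff)
  have mE: "m E \<subseteq> T" "card (m E) = 2" "m (m E) = E" using E m_sub m_card m_m by auto
  have mF: "card (m {e, s}) = 2" "m (m {e, s}) = {e, s}" using F m_card m_m by auto
  have fmE: "finite (m E)" using mE finite_T finite_subset by blast
  show False
  proof (cases "f \<in> m {e, s}")
    case False
    then have "m {e, s} \<subseteq> m E" using sub f m_disj[OF F(1,2)] by auto
    then have "m {e, s} = m E" using mE mF fmE by (simp add: card_subset_eq)
    then have "{e, s} = E" using mE mF by simp
    then show False using E(6) by auto
  next
    case True
    obtain p q where "m {e, s} = {p, q}" "p \<noteq> q" using mF(1) by (auto simp: card_2_iff)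
    then obtain g where g: "m {e, s} = {f, g}" "f \<noteq> g" using True by (cases "f = p") auto
    then have "g \<in> m E" using sub f m_disj[OF F(1,2)] by auto
    then have "m {f, g} = (E \<union> m E) - {f, g}" using m_transversal[OF E(1,2)] f by auto
    then have "s \<in> E \<union> m E" using mF(2) g by auto
    then show False using E(6) by auto
  qed
qed

end

section \<open>Parallel colourings\<close>

locale gewirtz =
  fixes V :: "'a set" and adj :: "'a \<Rightarrow> 'a \<Rightarrow> bool"
  assumes finite_V: "finite V" and card_V: "card V = 56"
    and adj_V: "adj u v \<Longrightarrow> u \<in> V" and adj_sym: "adj u v \<Longrightarrow> adj v u"
    and triangle_free: "adj u v \<Longrightarrow> adj v w \<Longrightarrow> \<not> adj u w"
    and degree: "u \<in> V \<Longrightarrow> card {w. adj u w} = 10"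
    and mu: "u \<in> V \<Longrightarrow> v \<in> V \<Longrightarrow> u \<noteq> v \<Longrightarrow> \<not> adj u v \<Longrightarrow> card {w. adj u w \<and> adj v w} = 2"
begin

lemma adj_irrefl: "\<not> adj u u"
  using triangle_free by blast

lemma adj_V2: "adj u v \<Longrightarrow> v \<in> V"
  using adj_V adj_sym by blast

lemma finite_adj: "finite {w. adj u w}"
  by (rule finite_subset[OF _ finite_V]) (auto dest: adj_V2)

text \<open>A common neighbour excludes adjacency, since there are no triangles, so
  \<open>mu\<close> supplies exactly one more. Hence every path of length two lies in a unique
  4-cycle.\<close>

lemma common_neighbours:
  assumes "u \<noteq> v" "adj u a" "adj v a"
  obtains b where "b \<noteq> a" "{w. adj u w \<and> adj v w} = {a, b}" "adj u b" "adj v b"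
proof -
  have "\<not> adj u v" using assms triangle_free adj_sym by blast
  then have "card {w. adj u w \<and> adj v w} = 2" using mu assms adj_V by blast
  then obtain p q where pq: "{w. adj u w \<and> adj v w} = {p, q}" "p \<noteq> q" by (auto simp: card_2_iff)
  moreover have "a \<in> {w. adj u w \<and> adj v w}" using assms by simp
  ultimately have "a = p \<or> a = q" by blast
  then have "\<exists>b. b \<noteq> a \<and> {w. adj u w \<and> adj v w} = {a, b}"
    using pq by (metis insert_commute)
  then obtain b where "b \<noteq> a" "{w. adj u w \<and> adj v w} = {a, b}" by blast
  then show ?thesis using that[of b] by auto
qed

lemma common_neighbours_cases:
  assumes "u \<noteq> v" "adj u a" "adj v a" "adj u b" "adj v b" "a \<noteq> b" "adj u c" "adj v c"
  shows "c = a \<or> c = b"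
proof -
  obtain b' where "{w. adj u w \<and> adj v w} = {a, b'}"
    using common_neighbours[OF assms(1-3)] by blast
  moreover have "b \<in> {w. adj u w \<and> adj v w}" "c \<in> {w. adj u w \<and> adj v w}" using assms by auto
  ultimately show ?thesis using assms(6) by auto
qed

end

text \<open>The final instance of \<open>R a b\<close> is that the edge \<open>{a, b}\<close> is
  reachable in the plus graph from a fixed edge.\<close>

locale parallel_colouring = gewirtz +
  fixes R :: "'a \<Rightarrow> 'a \<Rightarrow> bool"
  assumes R_sym: "R u v = R v u"
    and R_parallel: "adj a b \<Longrightarrow> adj b c \<Longrightarrow> adj c d \<Longrightarrow> adj d a \<Longrightarrow> a \<noteq> c \<Longrightarrow> b \<noteq> d \<Longrightarrow> R a b = R d c"
begin

text \<open>Exchanging the colours lets blue degree 1 be excluded together with red degree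
  1.\<close>

lemma complement_colouring: "parallel_colouring V adj (\<lambda>u v. \<not> R u v)"
proof unfold_locales
  show "(\<not> R u v) = (\<not> R v u)" for u v using R_sym by blast
  show "(\<not> R a b) = (\<not> R d c)"
    if "adj a b" "adj b c" "adj c d" "adj d a" "a \<noteq> c" "b \<noteq> d" for a b c d
    using R_parallel that by blast
qed

definition red :: "'a \<Rightarrow> 'a set" where
  "red u = {w. adj u w \<and> R u w}"

definition blue :: "'a \<Rightarrow> 'a set" where
  "blue u = {w. adj u w \<and> \<not> R u w}"

lemma finite_red: "finite (red u)" and finite_blue: "finite (blue u)"
  unfolding red_def blue_def by (rule finite_subset[OF _ finite_adj[of u]]; auto)+

lemma card_red_blue: "u \<in> V \<Longrightarrow> card (red u) + card (blue u) = 10"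
proof -
  assume "u \<in> V"
  have "red u \<union> blue u = {w. adj u w}" "red u \<inter> blue u = {}" by (auto simp: red_def blue_def)
  then show ?thesis using card_Un_disjoint[OF finite_red finite_blue, of u u] degree[OF \<open>u \<in> V\<close>] by simp
qed

text \<open>Each edge \<open>u w\<close> other than \<open>u v\<close> lies with \<open>u v\<close>
  in a unique 4-cycle, whose edge at \<open>v\<close> opposite to \<open>u w\<close> has the same
  colour. Mapping \<open>w\<close> to the far end of that edge is injective, since otherwise
  \<open>u\<close> and the common image would have three common neighbours.\<close>

lemma card_red_le:
  assumes uv: "adj u v"
  shows "card (red u) \<le> card (red v)"
proof -
  \<comment> \<open>The value \<open>u\<close> at \<open>w = v\<close> lets the edge
    \<open>u v\<close> correspond to itself.\<close>
  define f where "f w = (if w = v then u else SOME w'. adj v w' \<and> adj w w' \<and> w' \<noteq> u)" for w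
  have f: "adj v (f w) \<and> adj w (f w) \<and> f w \<noteq> u" if w: "adj u w" "w \<noteq> v" for w
  proof -
    obtain w' where "w' \<noteq> u" "adj v w'" "adj w w'"
      using common_neighbours[OF w(2)[symmetric] adj_sym[OF uv] adj_sym[OF w(1)]] by blast
    then have "\<exists>w'. adj v w' \<and> adj w w' \<and> w' \<noteq> u" by blast
    then show ?thesis unfolding f_def using that someI_ex[of "\<lambda>w'. adj v w' \<and> adj w w' \<and> w' \<noteq> u"] by auto
  qed
  have "inj_on f (red u)"
  proof
    fix p q assume pq: "p \<in> red u" "q \<in> red u" "f p = f q"
    show "p = q"
    proof (rule ccontr)
      assume ne: "p \<noteq> q"
      show False
      proof (cases "p = v \<or> q = v")
        case True
        then show False using f[of p] f[of q] pq ne by (auto simp: red_def f_def)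
      next
        case False
        then have P: "adj v (f p)" "adj p (f p)" "f p \<noteq> u" "adj q (f p)" "adj u p" "adj u q"
          using f[of p] f[of q] pq by (auto simp: red_def)
        then show False
          using common_neighbours_cases[of u "f p" p q v] ne False uv adj_sym by blast
      qed
    qed
  qed
  moreover have "f ` red u \<subseteq> red v"
  proof
    fix z assume "z \<in> f ` red u"
    then obtain w where w: "adj u w" "R u w" "z = f w" by (auto simp: red_def)
    show "z \<in> red v"
    proof (cases "w = v")
      case True
      then show ?thesis using w uv adj_sym R_sym by (auto simp: red_def f_def)
    next
      case False
      then have "adj v z" "adj w z" "z \<noteq> u" using f w by auto
      moreover then have "R u w = R v z" using R_parallel[of u w z v] w uv adj_sym False by blast
      ultimately show ?thesis using w by (auto simp: red_def)
    qed
  qed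
  ultimately show ?thesis using card_inj_on_le finite_red by blast
qed

text \<open>Equality along edges suffices because the graph has diameter two.\<close>

lemma card_red_eq:
  assumes "u \<in> V" "v \<in> V"
  shows "card (red u) = card (red v)"
proof -
  have adj: "card (red u) = card (red v)" if "adj u v" for u v
    using that card_red_le adj_sym by (simp add: dual_order.antisym)
  show ?thesis
  proof (cases "u = v \<or> adj u v")
    case False
    then have "card {w. adj u w \<and> adj v w} = 2" using mu assms by blast
    then have "{w. adj u w \<and> adj v w} \<noteq> {}" by force
    then obtain w where "adj u w" "adj v w" by blast
    then show ?thesis using adj by metis
  qed (use adj in blast)
qed

text \<open>The graph \<open>F\<close> on the eight neighbours of \<open>x\<close> outside the
  neighbourhood of \<open>y\<close> satisfies \<open>coloured_two_regular\<close> with colouring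
  \<open>R x\<close>.\<close>

lemma card_mixed_le:
  assumes xy: "x \<in> V" "y \<in> V" "x \<noteq> y" "\<not> adj x y"
  shows "card {(a, b). a \<in> red x \<and> b \<in> blue x \<and> (\<exists>z. z \<noteq> x \<and> adj z a \<and> adj z b \<and> adj z y)} \<le> 2"
proof -
  define S where "S = {a. adj x a \<and> \<not> adj y a}"
  define F where "F a b \<longleftrightarrow> a \<noteq> b \<and> adj x a \<and> adj x b \<and> (\<exists>z. z \<noteq> x \<and> adj z a \<and> adj z b \<and> adj z y)" for a b
  have FE: "\<exists>z. z \<noteq> x \<and> adj z a \<and> adj z b \<and> adj z y" if "F a b" for a b using that F_def by blast
  have "coloured_two_regular S F (R x)"
  proof
    show "finite S" unfolding S_def using finite_adj[of x] by (rule rev_finite_subset) auto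
    have S: "S = {w. adj x w} - {w. adj x w \<and> adj y w}" by (auto simp: S_def)
    moreover have "card {w. adj x w \<and> adj y w} = 2" using mu xy by blast
    moreover have "finite {w. adj x w \<and> adj y w}" using finite_adj[of x] by (rule rev_finite_subset) auto
    ultimately show "card S = 8" using degree[OF xy(1)]
      by (subst S, subst card_Diff_subset) auto
    show "\<not> F a a" for a by (simp add: F_def)
    show "F b a" if "F a b" for a b using that by (auto simp: F_def)
    show "a \<in> S" if Fab: "F a b" for a b
    proof -
      obtain z where "adj z a" "adj z y" using Fab FE by blast
      then have "\<not> adj y a" using triangle_free adj_sym by blast
      then show ?thesis using Fab by (auto simp: S_def F_def)
    qed
    \<comment> \<open>The two common neighbours \<open>z1\<close>, \<open>z2\<close> of
      \<open>a\<close> and \<open>y\<close> each share one further neighbour with \<open>x\<close>;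
      these are the two \<open>F\<close>-neighbours of \<open>a\<close>.\<close>
    show "card {b. F a b} = 2" if "a \<in> S" for a
    proof -
      have a: "adj x a" "\<not> adj y a" using that by (auto simp: S_def)
      have "a \<noteq> y" using a xy by blast
      then have "card {w. adj a w \<and> adj y w} = 2" using mu a xy adj_V2 adj_sym by metis
      then obtain z1 z2 where z: "{w. adj a w \<and> adj y w} = {z1, z2}" "z1 \<noteq> z2" by (auto simp: card_2_iff)
      then have z1: "adj a z1" "adj y z1" and z2: "adj a z2" "adj y z2" by auto
      have nx: "z1 \<noteq> x" "z2 \<noteq> x" using z1 z2 xy adj_sym by blast+
      obtain b1 where b1: "b1 \<noteq> a" "{w. adj x w \<and> adj z1 w} = {a, b1}" "adj x b1" "adj z1 b1"
        using common_neighbours[OF nx(1)[symmetric] a(1) adj_sym[OF z1(1)]] by blast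
      obtain b2 where b2: "b2 \<noteq> a" "{w. adj x w \<and> adj z2 w} = {a, b2}" "adj x b2" "adj z2 b2"
        using common_neighbours[OF nx(2)[symmetric] a(1) adj_sym[OF z2(1)]] by blast
      have "b1 \<noteq> b2"
        using common_neighbours_cases[of a b1 z1 z2 x] b1 b2 z1 z2 z(2) a adj_sym nx by blast
      have "{b. F a b} = {b1, b2}"
      proof
        show "{b. F a b} \<subseteq> {b1, b2}"
        proof
          fix b assume "b \<in> {b. F a b}"
          then obtain w where w: "w \<noteq> x" "adj w a" "adj w b" "adj w y" "a \<noteq> b" "adj x b"
            by (auto simp: F_def)
          then have "w \<in> {w. adj a w \<and> adj y w}" using adj_sym by blast
          then have "w = z1 \<or> w = z2" using z(1) by blast
          then have "b \<in> {a, b1} \<or> b \<in> {a, b2}" using w b1(2) b2(2) by blast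
          then show "b \<in> {b1, b2}" using w by blast
        qed
        have "F a b1" unfolding F_def using b1 a z1 nx adj_sym by blast
        moreover have "F a b2" unfolding F_def using b2 a z2 nx adj_sym by blast
        ultimately show "{b1, b2} \<subseteq> {b. F a b}" by blast
      qed
      then show ?thesis using \<open>b1 \<noteq> b2\<close> by simp
    qed
    show "R x e = R x f" if H: "F e a" "F a b" "F b f" "e \<noteq> b" "a \<noteq> f" for e a b f
    proof -
      have adjs: "adj x e" "adj x a" "adj x b" "adj x f" "e \<noteq> a" "a \<noteq> b" "b \<noteq> f"
        using H by (auto simp: F_def)
      obtain z1 where z1: "z1 \<noteq> x" "adj z1 e" "adj z1 a" "adj z1 y" using FE H by blast
      obtain z2 where z2: "z2 \<noteq> x" "adj z2 a" "adj z2 b" "adj z2 y" using FE H by blast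
      obtain z3 where z3: "z3 \<noteq> x" "adj z3 b" "adj z3 f" "adj z3 y" using FE H by blast
      have "z1 \<noteq> z2"
        using common_neighbours_cases[of x z1 e a b] z1 z2 adjs H by blast
      have "z3 \<noteq> z2"
        using common_neighbours_cases[of x z3 f b a] z2 z3 adjs H by blast
      have "a \<noteq> y" "b \<noteq> y" using adjs xy by blast+
      \<comment> \<open>The colour passes through four 4-cycles: \<open>x e z1 a\<close>,
        \<open>a z1 y z2\<close>, \<open>b z3 y z2\<close> and \<open>x f z3 b\<close>.\<close>
      have "R x e = R a z1" using R_parallel[of x e z1 a] adjs z1 adj_sym by blast
      also have "\<dots> = R z2 y" using R_parallel[of a z1 y z2] z1 z2 adj_sym \<open>a \<noteq> y\<close> \<open>z1 \<noteq> z2\<close> by blast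
      also have "\<dots> = R b z3" using R_parallel[of b z3 y z2] z3 z2 adj_sym \<open>b \<noteq> y\<close> \<open>z3 \<noteq> z2\<close> by blast
      also have "\<dots> = R x f" using R_parallel[of x f z3 b] adjs z3 adj_sym by blast
      finally show ?thesis .
    qed
  qed
  then have "card {(a, b). F a b \<and> R x a \<and> \<not> R x b} \<le> 2"
    by (rule coloured_two_regular.card_mixed_edges_le)
  moreover have "{(a, b). F a b \<and> R x a \<and> \<not> R x b} =
      {(a, b). a \<in> red x \<and> b \<in> blue x \<and> (\<exists>z. z \<noteq> x \<and> adj z a \<and> adj z b \<and> adj z y)}"
    unfolding F_def red_def blue_def by (intro Collect_cong) auto
  ultimately show ?thesis by (simp only:)
qed

text \<open>Double counting of red-blue pairs \<open>(a, b)\<close> against the 45 vertices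
  \<open>y\<close>. For a given pair, the vertices \<open>y\<close> are the eight neighbours, other
  than \<open>a\<close> and \<open>b\<close>, of the second common neighbour of \<open>a\<close> and
  \<open>b\<close>.\<close>

lemma card_red_times_card_blue_le:
  assumes x: "x \<in> V"
  shows "8 * (card (red x) * card (blue x)) \<le> 90"
proof -
  define Y where "Y = {y \<in> V. y \<noteq> x \<and> \<not> adj x y}"
  define P where "P = (\<lambda>(a, b) y. \<exists>z. z \<noteq> x \<and> adj z a \<and> adj z b \<and> adj z y)"
  have "Y = V - insert x {w. adj x w}" by (auto simp: Y_def)
  moreover have "card (insert x {w. adj x w}) = 11" using degree[OF x] finite_adj adj_irrefl by simp
  moreover have "insert x {w. adj x w} \<subseteq> V" using x adj_V2 by blast
  ultimately have card_Y: "card Y = 45" using card_V finite_adj by (simp add: card_Diff_subset)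
  have finite_Y: "finite Y" unfolding Y_def using finite_V by simp
  have 8: "card {y \<in> Y. P ab y} = 8" if ab_mem: "ab \<in> red x \<times> blue x" for ab
  proof -
    obtain a b where ab: "ab = (a, b)" "a \<in> red x" "b \<in> blue x" using ab_mem by auto
    then have adjs: "adj x a" "adj x b" "a \<noteq> b" by (auto simp: red_def blue_def)
    then obtain z where z: "z \<noteq> x" "{w. adj a w \<and> adj b w} = {x, z}" "adj a z" "adj b z"
      using common_neighbours[OF adjs(3) adj_sym[OF adjs(1)] adj_sym[OF adjs(2)]] by blast
    have "{y \<in> Y. P ab y} = {y. adj z y} - {a, b}"
    proof
      show "{y \<in> Y. P ab y} \<subseteq> {y. adj z y} - {a, b}"
      proof
        fix y assume "y \<in> {y \<in> Y. P ab y}"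
        then obtain w where w: "w \<noteq> x" "adj w a" "adj w b" "adj w y" and y: "y \<in> Y"
          by (auto simp: P_def ab)
        then have "w \<in> {w. adj a w \<and> adj b w}" using adj_sym by blast
        then have "w = z" using z(2) w by blast
        then show "y \<in> {y. adj z y} - {a, b}" using w y adjs by (auto simp: Y_def)
      qed
      show "{y. adj z y} - {a, b} \<subseteq> {y \<in> Y. P ab y}"
      proof
        fix y assume y: "y \<in> {y. adj z y} - {a, b}"
        have "y \<noteq> x" using y z adjs triangle_free adj_sym by blast
        moreover have "\<not> adj x y"
          using common_neighbours_cases[of x z a b y] y adjs z adj_sym by blast
        moreover have "y \<in> V" using y adj_V2 by blast
        moreover have "P ab y" unfolding P_def ab using y z adj_sym by blast
        ultimately show "y \<in> {y \<in> Y. P ab y}" by (simp add: Y_def)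
      qed
    qed
    moreover have "card {y. adj z y} = 10" using degree z adj_V2 by blast
    moreover have "{a, b} \<subseteq> {y. adj z y}" using z adj_sym by blast
    ultimately show ?thesis using \<open>a \<noteq> b\<close> by (simp add: card_Diff_subset)
  qed
  have 2: "card {ab \<in> red x \<times> blue x. P ab y} \<le> 2" if "y \<in> Y" for y
  proof -
    have "{ab \<in> red x \<times> blue x. P ab y} =
      {(a, b). a \<in> red x \<and> b \<in> blue x \<and> (\<exists>z. z \<noteq> x \<and> adj z a \<and> adj z b \<and> adj z y)}"
      unfolding P_def by auto
    then show ?thesis using card_mixed_le[of x y] that x by (auto simp: Y_def)
  qed
  have "(\<Sum>ab\<in>red x \<times> blue x. card {y \<in> Y. P ab y}) = (\<Sum>y\<in>Y. card {ab \<in> red x \<times> blue x. P ab y})"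
    by (rule sum_multicount_gen) (use finite_red finite_blue finite_Y in auto)
  also have "\<dots> \<le> (\<Sum>y\<in>Y. 2)" using 2 by (rule sum_mono)
  also have "\<dots> = 90" using card_Y by simp
  finally show ?thesis using 8 by (simp add: card_cartesian_product)
qed

end

section \<open>Colourings with a red perfect matching\<close>

locale matching_colouring = parallel_colouring +
  assumes card_red_one: "u \<in> V \<Longrightarrow> card (red u) = 1"
begin

definition mate :: "'a \<Rightarrow> 'a" where
  "mate u = (THE w. w \<in> red u)"

lemma red_mate: "u \<in> V \<Longrightarrow> red u = {mate u}"
proof -
  assume "u \<in> V"
  then obtain w where "red u = {w}" using card_red_one by (meson card_1_singletonE)
  then show ?thesis by (simp add: mate_def)
qed

lemma adj_mate: "u \<in> V \<Longrightarrow> adj u (mate u)"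
  using red_mate[of u] by (auto simp: red_def)

lemma R_mate: "u \<in> V \<Longrightarrow> R u (mate u)"
  using red_mate[of u] by (auto simp: red_def)

lemma mate_unique: "adj u w \<Longrightarrow> R u w \<Longrightarrow> w = mate u"
  using red_mate[of u] adj_V[of u w] by (auto simp: red_def)

lemma mate_V: "u \<in> V \<Longrightarrow> mate u \<in> V"
  using adj_mate adj_V2 by blast

lemma mate_mate: "u \<in> V \<Longrightarrow> mate (mate u) = u"
  using mate_unique[OF adj_sym[OF adj_mate]] R_mate R_sym by metis

text \<open>In the 4-cycle through \<open>mate u\<close>, \<open>u\<close>, \<open>v\<close> the
  edge at \<open>v\<close> opposite to the red edge is red, so it leads to
  \<open>mate v\<close>.\<close>

lemma adj_mate_mate:
  assumes uv: "adj u v"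
  shows "adj (mate u) (mate v)"
proof (cases "v = mate u")
  case True
  then show ?thesis using uv adj_sym mate_mate[OF adj_V[OF uv]] by simp
next
  case False
  have u: "u \<in> V" using uv adj_V by blast
  obtain w where w: "w \<noteq> u" "adj v w" "adj (mate u) w"
    using common_neighbours[OF False adj_sym[OF uv] adj_sym[OF adj_mate[OF u]]] by blast
  have "R u (mate u) = R v w"
    using R_parallel[of u "mate u" w v] w uv adj_mate[OF u] adj_sym False by blast
  then have "w = mate v" using mate_unique w R_mate u by blast
  then show ?thesis using w by simp
qed

end

section \<open>Vertices at distance two from \<open>x\<close> and pairs of blue neighbours of
  \<open>x\<close>\<close>

locale matching_colouring_at = matching_colouring +
  fixes x
  assumes x: "x \<in> V"
begin

definition common :: "'a \<Rightarrow> 'a set" where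
  "common y = {a. adj x a \<and> adj y a}"

definition far :: "'a set" where
  "far = {y \<in> V. y \<noteq> x \<and> \<not> adj x y \<and> common y \<subseteq> blue x}"

definition apex :: "'a set \<Rightarrow> 'a" where
  "apex P = (THE z. z \<noteq> x \<and> (\<forall>a\<in>P. adj z a))"

lemma farD: "y \<in> far \<Longrightarrow> y \<in> V" "y \<in> far \<Longrightarrow> y \<noteq> x" "y \<in> far \<Longrightarrow> \<not> adj x y"
  "y \<in> far \<Longrightarrow> common y \<subseteq> blue x"
  by (auto simp: far_def)

lemma blueD: "a \<in> blue x \<Longrightarrow> adj x a" "a \<in> blue x \<Longrightarrow> \<not> R x a"
  by (auto simp: blue_def)

lemma commonD: "a \<in> common y \<Longrightarrow> adj x a" "a \<in> common y \<Longrightarrow> adj y a"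
  by (auto simp: common_def)

lemma card_common: "y \<in> far \<Longrightarrow> card (common y) = 2"
  unfolding common_def using mu[OF x] farD by auto

lemma finite_common: "finite (common y)"
  unfolding common_def using finite_adj[of x] by (rule rev_finite_subset) auto

lemma card_blue: "card (blue x) = 9"
  using card_red_blue[OF x] card_red_one[OF x] by simp

text \<open>On pairs of blue neighbours, \<open>apex\<close> is the inverse of
  \<open>common\<close>: two neighbours of \<open>x\<close> have exactly one common neighbour
  besides \<open>x\<close>.\<close>

lemma apex_props:
  assumes P: "P \<subseteq> blue x" "card P = 2"
  shows "apex P \<in> far" "common (apex P) = P"
    "\<And>z. z \<noteq> x \<Longrightarrow> (\<And>a. a \<in> P \<Longrightarrow> adj z a) \<Longrightarrow> z = apex P"
proof -
  obtain a b where ab: "P = {a, b}" "a \<noteq> b" using P by (auto simp: card_2_iff)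
  then have xab: "adj x a" "adj x b" using P blueD by auto
  obtain z where z: "z \<noteq> x" "{w. adj a w \<and> adj b w} = {x, z}" "adj a z" "adj b z"
    using common_neighbours[OF ab(2) adj_sym[OF xab(1)] adj_sym[OF xab(2)]] by blast
  have uniq: "z' = z" if z': "z' \<noteq> x" "\<And>a. a \<in> P \<Longrightarrow> adj z' a" for z'
  proof -
    have "adj a z'" "adj b z'" using z' ab adj_sym by auto
    then show ?thesis using z(2) z'(1) by blast
  qed
  have zP: "adj z c" if "c \<in> P" for c using that z ab adj_sym by auto
  have apex: "apex P = z" unfolding apex_def
    by (rule the_equality) (use z zP uniq in blast)+
  show "\<And>z. z \<noteq> x \<Longrightarrow> (\<And>a. a \<in> P \<Longrightarrow> adj z a) \<Longrightarrow> z = apex P"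
    unfolding apex by (rule uniq)
  have "z \<in> V" using z adj_V2 by blast
  moreover have nxz: "\<not> adj x z" using triangle_free[OF xab(1) z(3)] .
  ultimately have "card (common z) = 2" unfolding common_def using mu[OF x, of z] z by auto
  moreover have "P \<subseteq> common z" using zP xab ab by (auto simp: common_def)
  ultimately have "common z = P" using P(2) card_subset_eq[OF finite_common] by metis
  then show "common (apex P) = P" "apex P \<in> far"
    unfolding apex far_def using P z \<open>z \<in> V\<close> nxz by auto
qed

lemma apex_common: "y \<in> far \<Longrightarrow> apex (common y) = y"
  using apex_props(3)[of "common y" y] farD[of y] card_common[of y] commonD by metis

text \<open>The edge \<open>c y\<close> is opposite to the edge from \<open>x\<close> to the other
  common neighbour, which is blue.\<close>

lemma common_not_red:
  assumes y: "y \<in> far" and c: "c \<in> common y"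
  shows "\<not> R c y"
proof -
  obtain d where d: "d \<noteq> c" "adj x d" "adj y d"
    using common_neighbours[OF farD(2)[OF y, symmetric] commonD[OF c]] by blast
  then have "d \<in> blue x" using farD[OF y] by (auto simp: common_def)
  moreover have "R c y = R x d"
    using R_parallel[of c y d x] d c farD[OF y] commonD[OF c] adj_sym by blast
  ultimately show ?thesis using blueD by blast
qed

text \<open>If \<open>mate y\<close> were adjacent to \<open>x\<close>, the red edge at
  \<open>y\<close> would be opposite to a blue edge at \<open>x\<close>. If \<open>mate x\<close>
  were adjacent to \<open>mate y\<close>, the automorphism would make \<open>x\<close> and
  \<open>y\<close> adjacent.\<close>

lemma mate_far:
  assumes y: "y \<in> far"
  shows "mate y \<in> far"
proof -
  have V: "y \<in> V" using farD y by blast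
  have m: "adj y (mate y)" using adj_mate V by blast
  have "mate y \<noteq> x" using m farD(3)[OF y] adj_sym by blast
  moreover have "\<not> adj x (mate y)"
  proof
    assume a: "adj x (mate y)"
    have "common y \<noteq> {}" using card_common[OF y] by force
    then obtain c where c: "c \<in> common y" by blast
    have "c \<noteq> mate y" using common_not_red[OF y c] R_mate[OF V] R_sym by blast
    then have "R y (mate y) = R c x"
      using R_parallel[of y "mate y" x c] m a commonD[OF c] farD[OF y] adj_sym by blast
    moreover have "\<not> R x c" using c farD(4)[OF y] blueD by blast
    ultimately show False using R_mate[OF V] R_sym by blast
  qed
  moreover have "common (mate y) \<subseteq> blue x"
  proof
    fix a assume a: "a \<in> common (mate y)"
    have "\<not> R x a"
    proof
      assume "R x a"
      then have "a = mate x" using mate_unique commonD[OF a] by blast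
      then have "adj (mate (mate x)) (mate (mate y))" using adj_mate_mate commonD[OF a] adj_sym by blast
      then show False using mate_mate x V farD[OF y] by simp
    qed
    then show "a \<in> blue x" using commonD[OF a] by (simp add: blue_def)
  qed
  ultimately show ?thesis using mate_V V by (simp add: far_def)
qed

lemma common_mate_disjoint:
  assumes y: "y \<in> far"
  shows "common (mate y) \<inter> common y = {}"
proof (rule equals0I)
  fix a assume a: "a \<in> common (mate y) \<inter> common y"
  then have "adj (mate y) a" "adj y a" using commonD by auto
  then show False using triangle_free[OF adj_mate] farD(1)[OF y] by blast
qed

definition block :: "'a \<Rightarrow> 'a set" where
  "block y = common y \<union> common (mate y)"

lemma block_mate: "y \<in> far \<Longrightarrow> block (mate y) = block y"
  using mate_mate farD by (auto simp: block_def)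

lemma card_block: "y \<in> far \<Longrightarrow> card (block y) = 4"
  unfolding block_def using common_mate_disjoint card_common mate_far finite_common
  by (subst card_Un_disjoint) auto

text \<open>A shared \<open>g\<close> would give the 4-cycle \<open>g y z (mate z)\<close>, making
  \<open>g y\<close> red against \<open>common_not_red\<close>.\<close>

lemma common_mate_disjoint_adj:
  assumes y: "y \<in> far" and z: "z \<in> far" and zy: "adj z y" and ne: "z \<noteq> mate y"
  shows "common (mate z) \<inter> common y = {}"
proof (rule equals0I)
  fix g assume "g \<in> common (mate z) \<inter> common y"
  then have g: "g \<in> common (mate z)" "g \<in> common y" by auto
  have V: "y \<in> V" "z \<in> V" using y z farD by auto
  have "g \<noteq> z" using farD(3)[OF z] commonD[OF g(1)] by blast
  moreover have "y \<noteq> mate z" using ne mate_mate V by metis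
  ultimately have "R g y = R (mate z) z"
    using R_parallel[of g y z "mate z"] commonD[OF g(1)] commonD[OF g(2)] zy adj_mate[OF V(2)] adj_sym
    by blast
  then show False using R_mate[OF V(2)] R_sym common_not_red[OF y g(2)] by blast
qed

lemma block_disjoint_adj:
  assumes y: "y \<in> far" and z: "z \<in> far" and zy: "adj z y" and ne: "z \<noteq> mate y"
  shows "block z \<inter> block y = {}"
proof -
  have tri: "common z \<inter> common y = {}" if "adj z y" for z y
    using triangle_free[OF that] by (auto simp: common_def)
  have V: "y \<in> V" "z \<in> V" using y z farD by auto
  have "y \<noteq> mate z" using ne mate_mate V by metis
  then have "common (mate y) \<inter> common z = {}"
    using common_mate_disjoint_adj[OF z y adj_sym[OF zy]] by blast
  moreover have "common (mate z) \<inter> common y = {}"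
    using common_mate_disjoint_adj[OF y z zy ne] .
  ultimately show ?thesis using tri[OF zy] tri[OF adj_mate_mate[OF zy]] unfolding block_def by blast
qed

lemma block_disjoint_near:
  assumes y: "y \<in> far" and z: "z \<in> far" and zy: "adj z y \<or> adj z (mate y)"
    and ne: "z \<noteq> y" "z \<noteq> mate y"
  shows "block z \<inter> block y = {}"
  using zy
proof
  assume "adj z y"
  then show ?thesis using block_disjoint_adj y z ne by blast
next
  assume "adj z (mate y)"
  then have "block z \<inter> block (mate y) = {}"
    using block_disjoint_adj[OF mate_far[OF y] z] ne mate_mate farD(1)[OF y] by simp
  then show ?thesis using block_mate[OF y] by simp
qed

text \<open>A counting argument: the four vertices of \<open>W\<close> are all of the form
  \<open>apex {e, g}\<close> with \<open>g\<close> outside the block, and there are only 9 - 4 - 1 =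
  4 choices of \<open>g\<close>. So every such apex occurs in \<open>W\<close>.\<close>

lemma apex_near:
  assumes y: "y \<in> far" and e: "e \<in> blue x - block y" and f: "f \<in> blue x - block y" and ef: "e \<noteq> f"
  shows "adj (apex {e, f}) y \<or> adj (apex {e, f}) (mate y)"
proof -
  have my: "mate y \<in> far" using mate_far y by blast
  have V: "y \<in> V" "mate y \<in> V" "e \<in> V" using y my e blueD adj_V2 farD by auto
  have xe: "adj x e" "\<not> R x e" using e blueD by auto
  have ne: "\<not> adj y e" "\<not> adj (mate y) e" using e xe by (auto simp: block_def common_def)
  have ney: "e \<noteq> y" "e \<noteq> mate y" using xe farD(3)[OF y] farD(3)[OF my] by auto
  define W where "W = {w. adj y w \<and> adj e w} \<union> {w. adj (mate y) w \<and> adj e w}"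
  have "card W = 4"
  proof -
    have "card {w. adj y w \<and> adj e w} = 2" "card {w. adj (mate y) w \<and> adj e w} = 2"
      using mu V ne ney by auto
    moreover have "{w. adj y w \<and> adj e w} \<inter> {w. adj (mate y) w \<and> adj e w} = {}"
      using triangle_free[OF adj_mate[OF V(1)]] by blast
    moreover have "finite {w. adj y w \<and> adj e w}" "finite {w. adj (mate y) w \<and> adj e w}"
      using finite_adj[of e] by (rule rev_finite_subset; auto)+
    ultimately show ?thesis unfolding W_def by (subst card_Un_disjoint) auto
  qed
  define D where "D = (\<lambda>f. apex {e, f}) ` (blue x - block y - {e})"
  have "block y \<subseteq> blue x" unfolding block_def using farD(4) y my by blast
  moreover have "finite (block y)" unfolding block_def using finite_common by blast
  ultimately have "card (blue x - block y) = 5"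
    using card_blue card_block[OF y] by (simp add: card_Diff_subset)
  then have "card (blue x - block y - {e}) = 4" using e finite_blue[of x] by simp
  then have "card D \<le> 4" unfolding D_def using card_image_le[of "blue x - block y - {e}"] finite_blue by force
  have "W \<subseteq> D"
  proof
    fix w assume "w \<in> W"
    then have w: "adj y w \<or> adj (mate y) w" "adj e w" by (auto simp: W_def)
    have w': "adj w y \<or> adj w (mate y)" using w adj_sym by blast
    have wV: "w \<in> V" using w adj_V2 by blast
    have wx: "w \<noteq> x" using w' farD(3)[OF y] farD(3)[OF my] by blast
    have nxw: "\<not> adj x w" using triangle_free[OF xe(1) w(2)] .
    obtain g where g: "g \<noteq> e" "{v. adj x v \<and> adj w v} = {e, g}" "adj x g" "adj w g"
      using common_neighbours[OF wx[symmetric] xe(1) adj_sym[OF w(2)]] by blast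
    have cw: "common w = {e, g}" using g(2) by (simp add: common_def)
    \<comment> \<open>If \<open>g\<close> were red, the opposite edge \<open>e w\<close> would be
      red. Then \<open>w\<close> is the mate of \<open>e\<close>, and the automorphism makes
      \<open>e\<close> adjacent to \<open>y\<close> or its mate.\<close>
    have "\<not> R x g"
    proof
      assume "R x g"
      moreover have "R x g = R e w"
        using R_parallel[of x g w e] g w xe wx adj_sym by blast
      ultimately have we: "w = mate e" using mate_unique w by blast
      have "adj (mate w) (mate y) \<or> adj (mate w) (mate (mate y))" using w' adj_mate_mate by blast
      then have "adj e (mate y) \<or> adj e y" using we mate_mate V by simp
      then show False using ne adj_sym by blast
    qed
    then have gb: "g \<in> blue x" using g by (simp add: blue_def)
    have wf: "w \<in> far" unfolding far_def using wV wx nxw cw gb e by auto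
    have "w \<noteq> y" "w \<noteq> mate y" using cw e by (auto simp: block_def)
    then have "block w \<inter> block y = {}" using block_disjoint_near[OF y wf w'] by blast
    then have "g \<notin> block y" using cw by (auto simp: block_def)
    moreover have "w = apex {e, g}" using apex_common[OF wf] cw by simp
    ultimately show "w \<in> D" unfolding D_def using gb g by blast
  qed
  moreover have "finite D" unfolding D_def using finite_blue by blast
  ultimately have "W = D" using \<open>card W = 4\<close> \<open>card D \<le> 4\<close> by (simp add: card_seteq)
  moreover have "apex {e, f} \<in> D" unfolding D_def using f ef by blast
  ultimately show ?thesis unfolding W_def using adj_sym by blast
qed

text \<open>For \<open>m_sep\<close>, the apex of a pair outside a block is adjacent to
  \<open>y\<close> or \<open>mate y\<close> by \<open>apex_near\<close>, and adjacency makes the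
  blocks disjoint.\<close>

lemma inconsistent: False
proof -
  have "pair_involution (blue x) (\<lambda>P. common (mate (apex P)))"
  proof
    show "card (blue x) = 9" by (rule card_blue)
    fix P assume P: "P \<subseteq> blue x" "card P = 2"
    define y where "y = apex P"
    have y: "y \<in> far" "common y = P" using apex_props[OF P] by (auto simp: y_def)
    have my: "mate y \<in> far" using mate_far y by blast
    show "common (mate (apex P)) \<subseteq> blue x" using farD(4)[OF my] by (simp add: y_def)
    show "card (common (mate (apex P))) = 2" using card_common[OF my] by (simp add: y_def)
    show "common (mate (apex P)) \<inter> P = {}" using common_mate_disjoint[OF y(1)] y(2) by (simp add: y_def)
    show "common (mate (apex (common (mate (apex P))))) = P"
      using apex_common[OF my] mate_mate farD(1)[OF y(1)] y(2) by (simp add: y_def)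
    fix E assume E: "E \<subseteq> blue x" "card E = 2" "E \<inter> (P \<union> common (mate (apex P))) = {}"
    define z where "z = apex E"
    have z: "z \<in> far" "common z = E" using apex_props[OF E(1,2)] by (auto simp: z_def)
    have B: "block y = P \<union> common (mate (apex P))" using y by (simp add: block_def y_def)
    obtain e f where ef: "E = {e, f}" "e \<noteq> f" using E(2) by (auto simp: card_2_iff)
    have "adj z y \<or> adj z (mate y)"
      unfolding z_def ef(1) by (rule apex_near[OF y(1)]) (use ef E B in auto)
    moreover have "z \<noteq> y" "z \<noteq> mate y" using z(2) E(3) ef B by (auto simp: block_def)
    ultimately have "block z \<inter> block y = {}" using block_disjoint_near[OF y(1) z(1)] by blast
    then show "common (mate (apex E)) \<inter> (P \<union> common (mate (apex P))) = {}"
      unfolding B by (auto simp: block_def z_def)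
  qed
  then show False by (rule pair_involution.inconsistent)
qed

end

section \<open>Every parallel colouring is constant\<close>

context parallel_colouring
begin

lemma card_red_neq_one:
  assumes "v \<in> V"
  shows "card (red v) \<noteq> 1"
proof
  assume one: "card (red v) = 1"
  then have "matching_colouring_at V adj R v"
    using assms card_red_eq by unfold_locales metis+
  then show False by (rule matching_colouring_at.inconsistent)
qed

theorem monochromatic:
  assumes "adj u v" "adj u' v'"
  shows "R u v = R u' v'"
proof -
  interpret co: parallel_colouring V adj "\<lambda>u v. \<not> R u v" by (rule complement_colouring)
  have V: "u \<in> V" "u' \<in> V" using assms adj_V by auto
  have co_red: "co.red u = blue u" by (simp add: co.red_def blue_def)
  have "card (red u) \<noteq> 1" "card (blue u) \<noteq> 1"
    using card_red_neq_one[OF V(1)] co.card_red_neq_one[OF V(1)] unfolding co_red by blast+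
  moreover have sum: "card (red u) + card (blue u) = 10" "card (red u') + card (blue u') = 10"
    using card_red_blue V by auto
  moreover have "8 * (card (red u) * card (blue u)) \<le> 90" using card_red_times_card_blue_le V by blast
  ultimately have "card (red u) = 0 \<or> card (blue u) = 0"
  proof -
    assume a: "card (red u) \<noteq> 1" "card (blue u) \<noteq> 1" "8 * (card (red u) * card (blue u)) \<le> 90"
    show ?thesis
    proof (rule ccontr)
      assume "\<not> ?thesis"
      \<comment> \<open>Both degrees are at least 2 and add up to 10, so their product is
        \<open>r * b + 16\<close>, too large for the bound.\<close>
      then obtain r b where "card (red u) = r + 2" "card (blue u) = b + 2"
        using a by (metis One_nat_def add_2_eq_Suc' not0_implies_Suc)
      moreover from this have "r + b = 6" using sum by simp
      ultimately show False using a(3) by (simp add: algebra_simps)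
    qed
  qed
  moreover have "card (red u) = card (red u')" using card_red_eq V by blast
  ultimately have "(red u = {} \<and> red u' = {}) \<or> (blue u = {} \<and> blue u' = {})"
    using sum finite_red finite_blue by auto
  then show ?thesis using assms by (auto simp: red_def blue_def)
qed

end

text \<open>For each fixed edge, reachability from it in the plus graph is a parallel colouring. It
  is constant on edges by \<open>monochromatic\<close>, and the fixed edge reaches itself.\<close>

theorem theorem4p6:
  fixes \<Gamma> :: "'a pair_pre_digraph"
  assumes "strongly_regular \<Gamma> 56 10 0 2"
  shows "Digraph_Component.connected (with_proj (plus_graph \<Gamma>))"
proof -
  have srg: "pair_graph \<Gamma>" "card (pverts \<Gamma>) = 56"
    "\<And>u. u \<in> pverts \<Gamma> \<Longrightarrow> out_degree (with_proj \<Gamma>) u = 10"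
    "\<And>u v. (u, v) \<in> parcs \<Gamma> \<Longrightarrow> u \<in> pverts \<Gamma> \<Longrightarrow> v \<in> pverts \<Gamma> \<Longrightarrow>
        card {w \<in> pverts \<Gamma>. (u, w) \<in> parcs \<Gamma> \<and> (v, w) \<in> parcs \<Gamma>} = 0"
    "\<And>u v. u \<in> pverts \<Gamma> \<Longrightarrow> v \<in> pverts \<Gamma> \<Longrightarrow> u \<noteq> v \<Longrightarrow> (u, v) \<notin> parcs \<Gamma> \<Longrightarrow>
        card {w \<in> pverts \<Gamma>. (u, w) \<in> parcs \<Gamma> \<and> (v, w) \<in> parcs \<Gamma>} = 2"
    using assms unfolding strongly_regular_def by auto
  interpret G: pair_graph \<Gamma> by (rule srg(1))
  interpret P: pair_graph "plus_graph \<Gamma>" by (rule pair_graph_plus_graph[OF srg(1)])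
  let ?P = "with_proj (plus_graph \<Gamma>)"
  define adj where "adj u v \<longleftrightarrow> (u, v) \<in> parcs \<Gamma>" for u v
  have adjV: "u \<in> pverts \<Gamma> \<and> v \<in> pverts \<Gamma>" if "adj u v" for u v
    using that G.in_arcsD1 G.in_arcsD2 by (auto simp: adj_def)
  have adj_sym: "adj v u" if "adj u v" for u v
    using that G.arcs_symmetric by (auto simp: adj_def)
  have gewirtz: "gewirtz (pverts \<Gamma>) adj"
  proof
    show "finite (pverts \<Gamma>)" by simp
    show "card (pverts \<Gamma>) = 56" by (rule srg(2))
    show "u \<in> pverts \<Gamma>" if "adj u v" for u v using adjV that by blast
    show "adj v u" if "adj u v" for u v using adj_sym that .
    show "\<not> adj u w" if uv: "adj u v" "adj v w" for u v w
    proof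
      assume uw: "adj u w"
      have "finite {w \<in> pverts \<Gamma>. (u, w) \<in> parcs \<Gamma> \<and> (v, w) \<in> parcs \<Gamma>}" by simp
      moreover have "card {w \<in> pverts \<Gamma>. (u, w) \<in> parcs \<Gamma> \<and> (v, w) \<in> parcs \<Gamma>} = 0"
        using srg(4)[of u v] uv(1) adjV[OF uv(1)] unfolding adj_def by blast
      ultimately have "{w \<in> pverts \<Gamma>. (u, w) \<in> parcs \<Gamma> \<and> (v, w) \<in> parcs \<Gamma>} = {}"
        by (simp only: card_0_eq)
      then show False using uv uw adjV by (auto simp: adj_def)
    qed
    show "card {w. adj u w} = 10" if "u \<in> pverts \<Gamma>" for u
    proof -
      have "out_arcs (with_proj \<Gamma>) u = Pair u ` {w. adj u w}"
        by (auto simp: out_arcs_def adj_def)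
      then show ?thesis using srg(3)[OF that] by (simp add: out_degree_def card_image inj_on_def)
    qed
    show "card {w. adj u w \<and> adj v w} = 2"
      if "u \<in> pverts \<Gamma>" "v \<in> pverts \<Gamma>" "u \<noteq> v" "\<not> adj u v" for u v
    proof -
      have "{w. adj u w \<and> adj v w} = {w \<in> pverts \<Gamma>. (u, w) \<in> parcs \<Gamma> \<and> (v, w) \<in> parcs \<Gamma>}"
        using adjV by (auto simp: adj_def)
      then show ?thesis using srg(5) that by (simp add: adj_def)
    qed
  qed
  have par: "({a, b}, {d, c}) \<in> parcs (plus_graph \<Gamma>)"
    if c: "adj a b" "adj b c" "adj c d" "adj d a" "a \<noteq> c" "b \<noteq> d" for a b c d
  proof -
    have ne: "a \<noteq> b" "b \<noteq> c" "c \<noteq> d" "d \<noteq> a"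
      using c by (auto simp: adj_def dest: G.no_loops')
    let ?p = "[(a, b), (b, c), (c, d), (d, a)]"
    have "pre_digraph.cycle (with_proj \<Gamma>) ?p \<and> length ?p = 4"
      unfolding four_cycle_iff using ne c adjV[OF c(1)] by (auto simp: adj_def)
    moreover have "{a, b} \<in> edge_of ` set ?p" "{d, c} \<in> edge_of ` set ?p"
      by (auto simp: edge_of_def insert_commute)
    moreover have "{a, b} \<inter> {d, c} = {}" using ne c by auto
    ultimately show ?thesis unfolding plus_graph_def by auto
  qed
  have reach: "{u, v} \<rightarrow>\<^sup>*\<^bsub>?P\<^esub> {u', v'}" if uv: "adj u v" and uv': "adj u' v'" for u v u' v'
  proof -
    have "parallel_colouring (pverts \<Gamma>) adj (\<lambda>a b. {u, v} \<rightarrow>\<^sup>*\<^bsub>?P\<^esub> {a, b})"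
    proof (intro parallel_colouring.intro gewirtz parallel_colouring_axioms.intro)
      show "({u, v} \<rightarrow>\<^sup>*\<^bsub>?P\<^esub> {a, b}) = ({u, v} \<rightarrow>\<^sup>*\<^bsub>?P\<^esub> {b, a})" for a b by (simp add: insert_commute)
      fix a b c d assume c: "adj a b" "adj b c" "adj c d" "adj d a" "a \<noteq> c" "b \<noteq> d"
      have "({a, b}, {d, c}) \<in> parcs (plus_graph \<Gamma>)" using par c by blast
      moreover from this have "({d, c}, {a, b}) \<in> parcs (plus_graph \<Gamma>)" using P.arcs_symmetric by blast
      ultimately show "({u, v} \<rightarrow>\<^sup>*\<^bsub>?P\<^esub> {a, b}) = ({u, v} \<rightarrow>\<^sup>*\<^bsub>?P\<^esub> {d, c})"
        using P.reachable_adj_trans by auto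
    qed
    then have "({u, v} \<rightarrow>\<^sup>*\<^bsub>?P\<^esub> {u, v}) = ({u, v} \<rightarrow>\<^sup>*\<^bsub>?P\<^esub> {u', v'})"
      using uv uv' by (rule parallel_colouring.monochromatic)
    moreover have "{u, v} \<in> pverts (plus_graph \<Gamma>)"
      using uv by (force simp: plus_graph_def edges_def edge_of_def adj_def)
    ultimately show ?thesis by simp
  qed
  have verts: "\<exists>u v. e = {u, v} \<and> adj u v" if "e \<in> pverts (plus_graph \<Gamma>)" for e
    using that unfolding plus_graph_def edges_def edge_of_def adj_def by (auto, blast)
  \<comment> \<open>Connectedness unfolds to strong connectedness of the symmetric closure, so a
    nonempty vertex set is also required.\<close>
  show ?thesis unfolding connected_def
  proof
    have "pverts \<Gamma> \<noteq> {}" using srg(2) by auto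
    then obtain u where "u \<in> pverts \<Gamma>" by blast
    then have "card {w. adj u w} = 10" using gewirtz.degree[OF gewirtz] by blast
    then have "{w. adj u w} \<noteq> {}" by force
    then obtain w where "adj u w" by blast
    then have "{u, w} \<in> verts ?P" by (force simp: plus_graph_def edges_def edge_of_def adj_def)
    then show "verts (with_proj (mk_symmetric ?P)) \<noteq> {}" by auto
    fix e f assume "e \<in> verts (with_proj (mk_symmetric ?P))" "f \<in> verts (with_proj (mk_symmetric ?P))"
    then obtain u v u' v' where "e = {u, v}" "adj u v" "f = {u', v'}" "adj u' v'"
      using verts[of e] verts[of f] by auto
    then show "e \<rightarrow>\<^sup>*\<^bsub>with_proj (mk_symmetric ?P)\<^esub> f"
      using reach P.reachable_mk_symmetricI by blast
  qed
qed

end
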